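(* Let $n>0$ be an integer. Let $I,J\subseteq\mathbb{R}$ be open intervals, let $g:I\to\mathbb{R}$ satisfy $g(I)\subseteq J$, and let $f:J\to\mathbb{R}$. If $f$ and $g$ possess derivatives up to order $n$ (on $J$ and $I$ respectively), then the composition $x\mapsto f(g(x))$ possesses derivatives up to order $n$ on $I$, and for every $x\in I$ its $n$th derivative is given by $$f(g(x))^{(n)} = \sum_{\pi\in\Pi_n} f^{(|\pi|)}(g(x)) \prod_{B\in\pi} g^{(|B|)}(x),$$ where $\pi$ ranges over the set $\Pi_n$ of all partitions of $\{1,\ldots,n\}$ and $B$ ranges over the blocks in $\pi$.
   Context: A partition of $\{1,\ldots,n\}$ is a set of nonempty, pairwise disjoint subsets (called blocks) whose union is $\{1,\ldots,n\}$; $\Pi_n$ is the set of all such partitions. For $\pi\in\Pi_n$, $|\pi|$ is the number of blocks of $\pi$, and for a block $B\in\pi$, $|B|$ is the number of elements of $B$. The notation $h^{(k)}$ denotes the $k$th derivative of $h$, and $f(g(x))^{(n)}$ denotes the $n$th derivative with respect to $x$ of the composite function $x\mapsto f(g(x))$. Derivatives are ordinary derivatives of real functions of one real variable; no continuity of the $n$th derivatives is assumed. *)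

theory Defs
  imports "HOL-Analysis.Analysis" "HOL-Library.Disjoint_Sets"
begin

text \<open>
  Functions on an interval are represented by total functions \<open>real \<Rightarrow> real\<close>, and the \<open>k\<close>-th
  derivative by \<open>(deriv ^^ k) h\<close>. The predicate below is meant for open \<open>S\<close>. There, if it holds,
  the values of \<open>(deriv ^^ k) h\<close> on \<open>S\<close> for \<open>k \<le> n\<close> are the genuine derivatives and depend only on
  the values of \<open>h\<close> on \<open>S\<close>. The last derivative is only required to exist, not to be continuous.
\<close>

definition has_derivs_upto :: "nat \<Rightarrow> (real \<Rightarrow> real) \<Rightarrow> real set \<Rightarrow> bool"
  where "has_derivs_upto n h S \<longleftrightarrow>
    (\<forall>k<n. \<forall>x\<in>S. (deriv ^^ k) h field_differentiable (at x))"

definition set_partitions :: "nat \<Rightarrow> nat set set set"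
  where "set_partitions n = {\<pi>. partition_on {1..n} \<pi>}"

end

theory Submission
  imports Defs
begin

text \<open>
  The set partitions in the formula record the bookkeeping of the chain and product rules. Attach to
  a partition \<open>\<pi>\<close> of a finite set \<open>A\<close> the term \<open>f\<^sup>(\<^sup>|\<^sup>\<pi>\<^sup>|\<^sup>) (g x) \<cdot> (\<Prod>B\<in>\<pi>. g\<^sup>(\<^sup>|\<^sup>B\<^sup>|\<^sup>) x)\<close>. Differentiating it
  either hits the outer factor, which raises \<open>|\<pi>|\<close> by one and produces a factor \<open>g'\<close>, or hits the
  factor of one block \<open>B\<close>, which raises \<open>|B|\<close> by one. These are exactly the terms of the partitions
  of \<open>insert a A\<close> that restrict to \<open>\<pi>\<close>: the new element \<open>a\<close> forms a block of its own, or it joins a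
  block \<open>B\<close>. Every partition of \<open>insert a A\<close> arises once in this way (\<open>sum_partition_on_insert\<close>), so
  the derivative of the sum for \<open>A\<close> is the sum for \<open>insert a A\<close> (\<open>has_derivative_faa_sum\<close>), and
  the formula follows by induction on the number of elements.

  The sum for \<open>A\<close> contains only derivatives of order at most \<open>card A\<close>, because a partition of \<open>A\<close>
  has at most \<open>card A\<close> blocks and each of them is a subset of \<open>A\<close>. So it is differentiable as long as
  \<open>card A < n\<close>, and the formula can be continued up to the order \<open>n\<close>.
\<close>

text \<open>
  A partition of \<open>insert a A\<close> is given by its restriction \<open>P\<close> to \<open>A\<close> together with the rest \<open>B\<close> of the
  block that contains \<open>a\<close>. This rest is a block of \<open>P\<close> or, when \<open>a\<close> is alone, the empty set; treating
  the empty set as one more choice of \<open>B\<close> makes a single bijection cover both cases.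
\<close>
lemma sum_partition_on_insert:
  fixes F :: "'a set set \<Rightarrow> 'b :: comm_monoid_add"
  assumes fin: "finite A" and a: "a \<notin> A"
  shows "(\<Sum>Q | partition_on (insert a A) Q. F Q) =
    (\<Sum>P | partition_on A P. F (insert {a} P) + (\<Sum>B\<in>P. F (insert (insert a B) (P - {B}))))"
proof -
  define S where "S = Sigma {P. partition_on A P} (\<lambda>P. insert {} P)"
  define rest where "rest Q = (THE C. C \<in> Q \<and> a \<in> C) - {a}" for Q :: "'a set set"
  define extend where "extend = (\<lambda>(P, B). insert (insert a B) (P - {B}))"
  \<comment> \<open>Removing \<open>{}\<close> matters when \<open>a\<close> is alone in its block and the rest is empty.\<close>
  define restrict where
    "restrict Q = (insert (rest Q) (Q - {insert a (rest Q)}) - {{}}, rest Q)" for Q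
  have extend_partition: "partition_on (insert a A) (extend s)"
    and restrict_extend: "restrict (extend s) = s" if s_in: "s \<in> S" for s
  proof -
    obtain P B where s: "s = (P, B)" and P: "partition_on A P" and B: "B \<in> insert {} P"
      using s_in by (auto simp: S_def)
    have un: "\<Union>P = A" and disj: "\<And>X Y. X \<in> P \<Longrightarrow> Y \<in> P \<Longrightarrow> X \<noteq> Y \<Longrightarrow> X \<inter> Y = {}"
      and ne: "{} \<notin> P"
      using P by (auto simp: partition_on_def disjoint_def)
    have aB: "a \<notin> B" and aP: "\<And>X. X \<in> P \<Longrightarrow> a \<notin> X"
      using a un B by auto
    have dB: "\<And>X. X \<in> P \<Longrightarrow> X \<noteq> B \<Longrightarrow> X \<inter> B = {}"
      using B disj by auto
    show "partition_on (insert a A) (extend s)"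
    proof (rule partition_onI)
      show "\<Union>(extend s) = insert a A"
        using B un by (auto simp: s extend_def)
      show "disjnt p q" if "p \<in> extend s" "q \<in> extend s" "p \<noteq> q" for p q
      proof -
        have "disjnt (insert a B) X" "disjnt X (insert a B)" if "X \<in> P" "X \<noteq> B" for X
          using aP[OF that(1)] dB[OF that] by (auto simp: disjnt_def)
        moreover have "disjnt X Y" if "X \<in> P" "Y \<in> P" "X \<noteq> Y" for X Y
          using disj[OF that] by (simp add: disjnt_def)
        moreover have "p = insert a B \<or> p \<in> P \<and> p \<noteq> B" "q = insert a B \<or> q \<in> P \<and> q \<noteq> B"
          using that(1,2) by (auto simp: s extend_def)
        ultimately show ?thesis
          using that(3) by metis
      qed
      show "{} \<notin> extend s"
        using ne by (auto simp: s extend_def)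
    qed
    have "(THE C. C \<in> extend s \<and> a \<in> C) = insert a B"
      using aP by (intro the_equality) (auto simp: s extend_def)
    then have rest: "rest (extend s) = B"
      using aB by (simp add: rest_def)
    have "extend s - {insert a B} = P - {B}"
      using aP by (auto simp: s extend_def)
    then have "restrict (extend s) = (insert B (P - {B}) - {{}}, B)"
      by (simp only: restrict_def rest)
    moreover have "insert B (P - {B}) - {{}} = P"
      using B ne by blast
    ultimately show "restrict (extend s) = s"
      by (simp only: s)
  qed
  have restrict_in: "restrict Q \<in> S" and extend_restrict: "extend (restrict Q) = Q"
    if Q: "partition_on (insert a A) Q" for Q
  proof -
    have un: "\<Union>Q = insert a A" and disj: "\<And>X Y. X \<in> Q \<Longrightarrow> Y \<in> Q \<Longrightarrow> X \<noteq> Y \<Longrightarrow> X \<inter> Y = {}"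
      and ne: "{} \<notin> Q"
      using Q by (auto simp: partition_on_def disjoint_def)
    obtain C where C: "C \<in> Q" "a \<in> C"
      using un by blast
    have aQ: "X = C" if "X \<in> Q" "a \<in> X" for X
      using disj[of X C] that C by auto
    have "(THE C. C \<in> Q \<and> a \<in> C) = C"
      by (rule the_equality) (simp add: C, rule aQ, simp_all)
    then have rest: "rest Q = C - {a}"
      by (simp add: rest_def)
    then have insert_rest: "insert a (rest Q) = C"
      using C by auto
    have dC: "\<And>X. X \<in> Q \<Longrightarrow> X \<noteq> C \<Longrightarrow> X \<inter> C = {}"
      using disj C by auto
    have "partition_on A (insert (C - {a}) (Q - {C}) - {{}})"
    proof (rule partition_onI)
      have "\<Union>(insert (C - {a}) (Q - {C}) - {{}}) = (C - {a}) \<union> \<Union>(Q - {C})"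
        by auto
      also have "\<dots> = (C \<union> \<Union>(Q - {C})) - {a}"
        using aQ by blast
      also have "C \<union> \<Union>(Q - {C}) = \<Union>Q"
        using C(1) by blast
      also have "\<dots> - {a} = A"
        unfolding un using a by simp
      finally show "\<Union>(insert (C - {a}) (Q - {C}) - {{}}) = A" .
      show "disjnt p q" if "p \<in> insert (C - {a}) (Q - {C}) - {{}}"
        "q \<in> insert (C - {a}) (Q - {C}) - {{}}" "p \<noteq> q" for p q
      proof -
        have "disjnt (C - {a}) X" "disjnt X (C - {a})" if "X \<in> Q" "X \<noteq> C" for X
          using dC[OF that] by (auto simp: disjnt_def)
        moreover have "disjnt X Y" if "X \<in> Q" "Y \<in> Q" "X \<noteq> Y" for X Y
          using disj[OF that] by (simp add: disjnt_def)
        moreover have "p = C - {a} \<or> p \<in> Q \<and> p \<noteq> C" "q = C - {a} \<or> q \<in> Q \<and> q \<noteq> C"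
          using that(1,2) by auto
        ultimately show ?thesis
          using that(3) by metis
      qed
    qed auto
    then show "restrict Q \<in> S"
      by (auto simp: S_def restrict_def rest insert_rest C(2) insert_absorb)
    \<comment> \<open>The rest of \<open>C\<close> is not itself in \<open>Q\<close>, so inserting and removing it changes nothing else.\<close>
    have "C - {a} \<notin> Q"
    proof
      assume Ca: "C - {a} \<in> Q"
      have "C - {a} \<noteq> C"
        using C(2) by blast
      then have "C - {a} = {}"
        using dC[OF Ca] by blast
      then show False
        using Ca ne by metis
    qed
    then show "extend (restrict Q) = Q"
      using C ne by (auto simp: extend_def restrict_def insert_rest rest insert_absorb)
  qed
  have "(\<Sum>Q | partition_on (insert a A) Q. F Q) = (\<Sum>s\<in>S. F (extend s))"
    by (rule sum.reindex_bij_witness[of _ extend restrict])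
      (auto simp: extend_partition restrict_extend restrict_in extend_restrict)
  also have "\<dots> = (\<Sum>P | partition_on A P. \<Sum>B\<in>insert {} P. F (extend (P, B)))"
    unfolding S_def using finitely_many_partition_on[OF fin] finite_elements[OF fin]
    by (subst sum.Sigma) auto
  also have "\<dots> = (\<Sum>P | partition_on A P. F (insert {a} P) +
      (\<Sum>B\<in>P. F (insert (insert a B) (P - {B}))))"
  proof (rule sum.cong[OF refl])
    fix P assume "P \<in> {P. partition_on A P}"
    then have "{} \<notin> P" "finite P"
      using finite_elements[OF fin] by (auto simp: partition_on_def)
    then show "(\<Sum>B\<in>insert {} P. F (extend (P, B))) =
        F (insert {a} P) + (\<Sum>B\<in>P. F (insert (insert a B) (P - {B})))"
      by (simp add: extend_def)
  qed
  finally show ?thesis .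
qed

definition faa_term :: "(real \<Rightarrow> real) \<Rightarrow> (real \<Rightarrow> real) \<Rightarrow> real \<Rightarrow> 'a set set \<Rightarrow> real"
  where "faa_term f g x P = (deriv ^^ card P) f (g x) * (\<Prod>B\<in>P. (deriv ^^ card B) g x)"

lemma has_derivs_upto_DERIV:
  assumes "has_derivs_upto n h S" "k < n" "x \<in> S"
  shows "((deriv ^^ k) h has_real_derivative (deriv ^^ Suc k) h x) (at x)"
  using assms by (auto simp: has_derivs_upto_def DERIV_deriv_iff_field_differentiable)

text \<open>
  The chain rule on the outer factor yields the extension of \<open>P\<close> by the block \<open>{a}\<close>, the product rule
  on the others yields the extensions in which \<open>a\<close> joins one of the blocks.
\<close>
lemma has_derivative_faa_term:
  assumes fin: "finite A" and a: "a \<notin> A" and P: "partition_on A P" and "card A < n"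
    and f: "has_derivs_upto n f J" and g: "has_derivs_upto n g I"
    and x: "x \<in> I" "g x \<in> J"
  shows "((\<lambda>x. faa_term f g x P) has_real_derivative
    faa_term f g x (insert {a} P) + (\<Sum>B\<in>P. faa_term f g x (insert (insert a B) (P - {B})))) (at x)"
proof -
  have finP: "finite P" and sub: "\<And>B. B \<in> P \<Longrightarrow> B \<subseteq> A"
    using P finite_elements[OF fin P] by (auto simp: partition_on_def)
  have finB: "finite B" and aB: "a \<notin> B" and cardB: "card B < n" if "B \<in> P" for B
    using sub[OF that] fin a card_mono[OF fin sub[OF that]] \<open>card A < n\<close>
    by (auto intro: finite_subset)
  have "card P \<le> card A"
  proof -
    have "card P = (\<Sum>B\<in>P. 1)"
      by simp
    also have "\<dots> \<le> (\<Sum>B\<in>P. card B)"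
      using finB P by (intro sum_mono) (auto simp: partition_on_def Suc_le_eq card_gt_0_iff)
    also have "\<dots> = card A"
      using product_partition[OF P finB] by simp
    finally show ?thesis .
  qed
  then have cardP: "card P < n" and "0 < n"
    using \<open>card A < n\<close> by auto
  have g': "(g has_real_derivative deriv g x) (at x)"
    using has_derivs_upto_DERIV[OF g \<open>0 < n\<close> x(1)] by simp
  have outer: "((\<lambda>x. (deriv ^^ card P) f (g x)) has_real_derivative
      (deriv ^^ Suc (card P)) f (g x) * deriv g x) (at x)"
    by (rule DERIV_chain2[OF has_derivs_upto_DERIV[OF f cardP x(2)] g'])
  have inner: "((\<lambda>x. \<Prod>B\<in>P. (deriv ^^ card B) g x) has_real_derivative
      (\<Sum>B\<in>P. (deriv ^^ Suc (card B)) g x * (\<Prod>C\<in>P - {B}. (deriv ^^ card C) g x))) (at x)"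
    by (rule has_field_derivative_prod) (rule has_derivs_upto_DERIV[OF g cardB x(1)])
  have "faa_term f g x (insert {a} P) =
      (deriv ^^ Suc (card P)) f (g x) * deriv g x * (\<Prod>B\<in>P. (deriv ^^ card B) g x)"
    using finP aB by (subst faa_term_def) (auto simp: card_insert_if)
  moreover have "faa_term f g x (insert (insert a B) (P - {B})) = (deriv ^^ card P) f (g x) *
      ((deriv ^^ Suc (card B)) g x * (\<Prod>C\<in>P - {B}. (deriv ^^ card C) g x))" if "B \<in> P" for B
  proof -
    have new: "insert a B \<notin> P - {B}"
      using aB by blast
    have "card (insert (insert a B) (P - {B})) = card P"
      using new finP that card_Suc_Diff1[OF finP that] by simp
    moreover have "card (insert a B) = Suc (card B)"
      using finB aB that by simp
    ultimately show ?thesis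
      using new finP by (simp add: faa_term_def del: funpow.simps)
  qed
  ultimately show ?thesis
    using DERIV_mult[OF outer inner] unfolding faa_term_def[of f g _ P, abs_def]
    by (simp add: sum_distrib_left algebra_simps del: funpow.simps)
qed

lemma has_derivative_faa_sum:
  assumes "finite A" and "a \<notin> A" and "card A < n"
    and "has_derivs_upto n f J" and "has_derivs_upto n g I"
    and "x \<in> I" "g x \<in> J"
  shows "((\<lambda>x. \<Sum>P | partition_on A P. faa_term f g x P) has_real_derivative
    (\<Sum>Q | partition_on (insert a A) Q. faa_term f g x Q)) (at x)"
  unfolding sum_partition_on_insert[OF assms(1,2)]
  by (rule DERIV_sum) (use assms in \<open>auto intro: has_derivative_faa_term\<close>)

text \<open>
  The induction also runs through \<open>m = 0\<close>, where the only partition is the empty one and the sum is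
  the composition itself. That \<open>I\<close> is open lets the formula for \<open>m\<close>, known on \<open>I\<close> only, determine
  the next derivative at each point of \<open>I\<close>.
\<close>
lemma faa_di_bruno_DERIV:
  fixes f g :: "real \<Rightarrow> real"
  assumes "open I" and sub: "g ` I \<subseteq> J"
    and f: "has_derivs_upto n f J" and g: "has_derivs_upto n g I"
  defines "s \<equiv> \<lambda>m x. \<Sum>P | partition_on {1..m::nat} P. faa_term f g x P"
  shows deriv_compose_eq: "m \<le> n \<Longrightarrow> x \<in> I \<Longrightarrow> (deriv ^^ m) (\<lambda>x. f (g x)) x = s m x"
    and DERIV_deriv_compose: "m < n \<Longrightarrow> x \<in> I \<Longrightarrow>
      ((deriv ^^ m) (\<lambda>x. f (g x)) has_real_derivative s (Suc m) x) (at x)"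
proof -
  have step: "((deriv ^^ m) (\<lambda>x. f (g x)) has_real_derivative s (Suc m) x) (at x)"
    if "m < n" "x \<in> I" and eq: "\<And>x. x \<in> I \<Longrightarrow> (deriv ^^ m) (\<lambda>x. f (g x)) x = s m x" for m x
  proof -
    have "(s m has_real_derivative s (Suc m) x) (at x)"
      using has_derivative_faa_sum[of "{1..m}" "Suc m" n f J g I x] that f g sub
      unfolding s_def by (auto simp: atLeastAtMostSuc_conv)
    then show ?thesis
      using \<open>open I\<close> \<open>x \<in> I\<close> by (rule has_field_derivative_transform_within_open) (simp add: eq)
  qed
  show eq: "(deriv ^^ m) (\<lambda>x. f (g x)) x = s m x" if "m \<le> n" "x \<in> I" for m x
    using that
  proof (induction m arbitrary: x)
    case 0
    have "{P. partition_on {1..0::nat} P} = {{}}"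
      by (auto simp: partition_on_empty)
    then show ?case
      by (simp add: s_def faa_term_def)
  next
    case (Suc m)
    then show ?case
      using DERIV_imp_deriv[OF step[of m x]] by simp
  qed
  show "((deriv ^^ m) (\<lambda>x. f (g x)) has_real_derivative s (Suc m) x) (at x)"
    if "m < n" "x \<in> I" for m x
    using that by (intro step eq) auto
qed

theorem theorem1:
  fixes n :: nat and I J :: "real set" and f g :: "real \<Rightarrow> real"
  assumes "n > 0"
    and "open I" and "is_interval I"
    and "open J" and "is_interval J"
    and "g ` I \<subseteq> J"
    and "has_derivs_upto n f J"
    and "has_derivs_upto n g I"
  shows "has_derivs_upto n (\<lambda>x. f (g x)) I \<and>
    (\<forall>x\<in>I. (deriv ^^ n) (\<lambda>x. f (g x)) x =
      (\<Sum>\<pi>\<in>set_partitions n. (deriv ^^ card \<pi>) f (g x) * (\<Prod>B\<in>\<pi>. (deriv ^^ card B) g x)))"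
proof
  show "has_derivs_upto n (\<lambda>x. f (g x)) I"
    using DERIV_deriv_compose[OF assms(2,6,7,8)]
    by (auto simp: has_derivs_upto_def field_differentiable_def)
  show "\<forall>x\<in>I. (deriv ^^ n) (\<lambda>x. f (g x)) x =
      (\<Sum>\<pi>\<in>set_partitions n. (deriv ^^ card \<pi>) f (g x) * (\<Prod>B\<in>\<pi>. (deriv ^^ card B) g x))"
    using deriv_compose_eq[OF assms(2,6,7,8), of n]
    by (simp add: set_partitions_def faa_term_def)
qed

end
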